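(* Let $p$ be an odd prime. Then there exists a $p$-group $P$ of order $p^6$ whose Chermak-Delgado lattice is a chain $\mathrm{Z}(P) < A < P$ of length 2, i.e. $\mathcal{CD}(P) = \{\mathrm{Z}(P), A, P\}$ for some subgroup $A$ with $\mathrm{Z}(P) < A < P$ (proper inclusions).
   Context: For a finite group $G$ and a subgroup $U \le G$, the Chermak-Delgado measure of $U$ in $G$ is $m_G(U) = |U|\,|C_G(U)|$. Put $m(G) = \max\{m_G(U) \mid U \le G\}$ and $\mathcal{CD}(G) = \{U \le G \mid m_G(U) = m(G)\}$, the Chermak-Delgado lattice of $G$. $\mathrm{Z}(P)$ denotes the center of $P$. *)

theory Defs
  imports "HOL-Algebra.Coset" "HOL-Computational_Algebra.Primes"
begin

definition centralizer :: "('a, 'b) monoid_scheme \<Rightarrow> 'a set \<Rightarrow> 'a set" where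
  "centralizer G U =
     {g \<in> carrier G. \<forall>u\<in>U. g \<otimes>\<^bsub>G\<^esub> u = u \<otimes>\<^bsub>G\<^esub> g}"

definition group_center :: "('a, 'b) monoid_scheme \<Rightarrow> 'a set" where
  "group_center G = centralizer G (carrier G)"

definition cd_measure :: "('a, 'b) monoid_scheme \<Rightarrow> 'a set \<Rightarrow> nat" where
  "cd_measure G U = card U * card (centralizer G U)"

text \<open>The following two definitions are meaningful only for finite groups, where the set
  under \<open>Max\<close> is finite and nonempty.\<close>

definition max_cd_measure :: "('a, 'b) monoid_scheme \<Rightarrow> nat" where
  "max_cd_measure G = Max {cd_measure G U | U. subgroup U G}"

definition chermak_delgado_lattice :: "('a, 'b) monoid_scheme \<Rightarrow> 'a set set" where
  "chermak_delgado_lattice G = {U. subgroup U G \<and> cd_measure G U = max_cd_measure G}"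

end

theory Submission
  imports Defs "HOL-Algebra.Weak_Morphisms" "HOL-Library.Countable" "HOL-Number_Theory.Cong"
begin

text \<open>Let \<open>F = GF(p\<^sup>2)\<close>. Take a group of triples \<open>(s, b, c)\<close> over \<open>F\<close> with \<open>A = {s = 0}\<close> and
  \<open>Z = {s = b = 0}\<close>, in which \<open>s\<close> acts on the abelian group \<open>A\<close> by \<open>(b, c) \<mapsto> (b, c + s b)\<close>. As \<open>F\<close>
  has no zero divisors, an element of \<open>A - Z\<close> commutes only with elements of \<open>A\<close>. In the Heisenberg
  group over \<open>F\<close> further abelian subgroups of order \<open>p\<^sup>4\<close> lie in the lattice; they are destroyed by
  a twist that makes elements with \<open>GF(p)\<close>-independent \<open>s\<close> have a nontrivial commutator modulo \<open>Z\<close>.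
  Then every element outside \<open>A\<close> has a centralizer of order at most \<open>p\<^sup>3\<close>. Hence, if neither \<open>U\<close> nor
  its centralizer \<open>C\<close> lies in \<open>A\<close>, then \<open>|U| |C| \<le> p\<^sup>6\<close>; the remaining cases give at most \<open>p\<^sup>8\<close>, with
  equality only for \<open>Z\<close>, \<open>A\<close> and the whole group.\<close>

section \<open>Centralizers and the counting argument for a chain of length two\<close>

lemma centralizer_subset: "centralizer G U \<subseteq> carrier G"
  by (auto simp: centralizer_def)

lemma subgroup_centralizer:
  assumes "group G" and "U \<subseteq> carrier G"
  shows "subgroup (centralizer G U) G"
proof -
  interpret group G by fact
  show ?thesis
  proof (rule subgroupI)
    show "centralizer G U \<subseteq> carrier G"
      by (rule centralizer_subset)
    have "\<one>\<^bsub>G\<^esub> \<in> centralizer G U"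
      using assms(2) by (auto simp: centralizer_def)
    then show "centralizer G U \<noteq> {}"
      by blast
  next
    fix a assume a: "a \<in> centralizer G U"
    have "inv\<^bsub>G\<^esub> a \<otimes>\<^bsub>G\<^esub> u = u \<otimes>\<^bsub>G\<^esub> inv\<^bsub>G\<^esub> a" if "u \<in> U" for u
    proof -
      have u: "u \<in> carrier G" "a \<in> carrier G" "a \<otimes>\<^bsub>G\<^esub> u = u \<otimes>\<^bsub>G\<^esub> a"
        using a that assms(2) by (auto simp: centralizer_def)
      then have "u = inv\<^bsub>G\<^esub> a \<otimes>\<^bsub>G\<^esub> (u \<otimes>\<^bsub>G\<^esub> a)"
        by (metis inv_closed l_inv l_one m_assoc)
      then show ?thesis
        using u by (metis inv_closed inv_solve_right' m_assoc m_closed)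
    qed
    then show "inv\<^bsub>G\<^esub> a \<in> centralizer G U"
      using a by (auto simp: centralizer_def)
  next
    fix a b assume "a \<in> centralizer G U" and "b \<in> centralizer G U"
    then show "a \<otimes>\<^bsub>G\<^esub> b \<in> centralizer G U"
      using assms(2) unfolding centralizer_def by (auto simp: subset_iff) (metis m_assoc)
  qed
qed

text \<open>Serves the equality case of the counting: since \<open>b\<close> is positive, a product
  that reaches the bound leaves no slack in its first factor.\<close>

lemma nat_mult_le_eq:
  fixes m n a b k :: nat
  assumes "m \<le> a" and "n \<le> b" and "a * b = k" and "0 < k"
  shows "m * n \<le> k" and "m * n = k \<Longrightarrow> m = a"
proof -
  show "m * n \<le> k"
    using assms by (auto intro: mult_le_mono)
  show "m = a" if "m * n = k"
  proof (rule ccontr)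
    assume "m \<noteq> a"
    then have "m * b < a * b"
      using assms by (intro mult_strict_right_mono) auto
    moreover have "m * n \<le> m * b"
      using assms by simp
    ultimately show False
      using that assms by simp
  qed
qed

text \<open>Separates the counting from the arithmetic of the concrete group:
  \<open>A_noncomm\<close> carries the absence of zero divisors, \<open>small\<close> the effect of
  the twist.\<close>

lemma chermak_delgado_chain:
  fixes p :: nat
  assumes "group G" and p: "1 < p"
    and card_G: "card (carrier G) = p ^ 6" and card_A: "card A = p ^ 4" and card_Z: "card Z = p ^ 2"
    and ZA: "Z \<subseteq> A" and AG: "A \<subseteq> carrier G"
    and Z_central: "\<And>z g. z \<in> Z \<Longrightarrow> g \<in> carrier G \<Longrightarrow> z \<otimes>\<^bsub>G\<^esub> g = g \<otimes>\<^bsub>G\<^esub> z"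
    and A_comm: "\<And>a b. a \<in> A \<Longrightarrow> b \<in> A \<Longrightarrow> a \<otimes>\<^bsub>G\<^esub> b = b \<otimes>\<^bsub>G\<^esub> a"
    and A_noncomm: "\<And>a g. a \<in> A - Z \<Longrightarrow> g \<in> carrier G - A \<Longrightarrow> a \<otimes>\<^bsub>G\<^esub> g \<noteq> g \<otimes>\<^bsub>G\<^esub> a"
    and small: "\<And>c. c \<in> carrier G - A \<Longrightarrow> card (centralizer G {c}) \<le> p ^ 3"
  shows "subgroup A G" and "group_center G \<subset> A" and "A \<subset> carrier G"
    and "chermak_delgado_lattice G = {group_center G, A, carrier G}"
proof -
  interpret group G by fact
  have fin: "finite (carrier G)"
    using card_G p by (intro card_ge_0_finite) auto
  note finA = finite_subset[OF AG fin] and finC = finite_subset[OF centralizer_subset fin]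
  have ZA': "Z \<subset> A"
    using ZA card_A card_Z p by (metis order.not_eq_order_implies_strict numeral_eq_iff
        power_inject_exp semiring_norm(87) num.distinct(1))
  have AG': "A \<subset> carrier G"
    using AG card_A card_G p by (metis order.not_eq_order_implies_strict numeral_eq_iff
        power_inject_exp semiring_norm(87) num.distinct(5))
  have C_A: "centralizer G A = A"
  proof
    obtain a where "a \<in> A - Z"
      using ZA' by blast
    then show "centralizer G A \<subseteq> A"
      using A_noncomm[of a] by (fastforce simp: centralizer_def)
    show "A \<subseteq> centralizer G A"
      using A_comm AG by (auto simp: centralizer_def)
  qed
  have center: "group_center G = Z"
  proof
    show "Z \<subseteq> group_center G"
      using Z_central ZA AG by (auto simp: group_center_def centralizer_def)
    show "group_center G \<subseteq> Z"
    proof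
      fix g assume "g \<in> group_center G"
      then have g: "g \<in> carrier G" "\<And>h. h \<in> carrier G \<Longrightarrow> g \<otimes>\<^bsub>G\<^esub> h = h \<otimes>\<^bsub>G\<^esub> g"
        by (auto simp: group_center_def centralizer_def)
      \<comment> \<open>A centralizer this large contradicts \<open>small\<close> unless
        \<open>g\<close> lies in \<open>A\<close>; commuting with an element outside
        \<open>A\<close> then forces \<open>g\<close> into \<open>Z\<close>.\<close>
      then have "centralizer G {g} = carrier G"
        by (auto simp: centralizer_def)
      moreover have "p ^ 3 < p ^ 6"
        using p by simp
      ultimately have "g \<in> A"
        using small[of g] g(1) card_G by auto
      then show "g \<in> Z"
        using A_noncomm[of g] g(2) AG' by blast
    qed
  qed
  have C_Z: "centralizer G Z = carrier G"
    using Z_central ZA AG by (auto simp: centralizer_def)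
  have m: "cd_measure G Z = p ^ 8" "cd_measure G A = p ^ 8" "cd_measure G (carrier G) = p ^ 8"
    using C_Z C_A center card_A card_G card_Z
    by (simp_all add: cd_measure_def group_center_def flip: power_add)
  have bound: "cd_measure G U \<le> p ^ 8 \<and> (cd_measure G U = p ^ 8 \<longrightarrow> U \<in> {Z, A, carrier G})"
    if U: "U \<subseteq> carrier G" for U
  proof -
    let ?C = "centralizer G U"
    have p8: "0 < p ^ 8"
      using p by simp
    have comm: "u \<otimes>\<^bsub>G\<^esub> g = g \<otimes>\<^bsub>G\<^esub> u" if "u \<in> U" "g \<in> ?C" for u g
      using that by (auto simp: centralizer_def)
    have UC: "card U \<le> p ^ 6" "card ?C \<le> p ^ 6"
      using card_mono[OF fin U] card_mono[OF fin centralizer_subset, of U] card_G by auto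
    \<comment> \<open>In the first three cases the orders of \<open>U\<close> and \<open>?C\<close>
      are bounded by \<open>p^2, p^6\<close>, by \<open>p^4, p^4\<close> and by
      \<open>p^6, p^2\<close>. Equality makes \<open>U\<close> as large as the set containing it,
      hence equal to that set.\<close>
    consider "U \<subseteq> Z" | a where "U \<subseteq> A" "a \<in> U" "a \<notin> Z"
      | c where "c \<in> U" "c \<notin> A" "?C \<subseteq> A" | c c' where "c \<in> U" "c \<notin> A" "c' \<in> ?C" "c' \<notin> A"
      by blast
    then show ?thesis
    proof cases
      case 1
      then have "card U \<le> p ^ 2"
        using card_mono[OF finite_subset[OF ZA finA]] card_Z by metis
      note * = nat_mult_le_eq[OF this UC(2) _ p8]
      show ?thesis
        using * card_subset_eq[OF finite_subset[OF ZA finA] 1] card_Z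
        by (auto simp: cd_measure_def simp flip: power_add)
    next
      case 2
      then have "?C \<subseteq> A"
        using A_noncomm[of a] comm centralizer_subset[of G U] by blast
      then have "card U \<le> p ^ 4" "card ?C \<le> p ^ 4"
        using card_mono[OF finA] 2 card_A by metis+
      note * = nat_mult_le_eq[OF this _ p8]
      show ?thesis
        using * card_subset_eq[OF finA 2(1)] card_A
        by (auto simp: cd_measure_def simp flip: power_add)
    next
      case 3
      have "?C \<subseteq> Z"
      proof
        fix a assume "a \<in> ?C"
        then show "a \<in> Z"
          using A_noncomm[of a c] comm[of c a] 3 U by auto
      qed
      then have "card ?C \<le> p ^ 2"
        using card_mono[OF finite_subset[OF ZA finA]] card_Z by metis
      note * = nat_mult_le_eq[OF UC(1) this _ p8]
      show ?thesis
        using * card_subset_eq[OF fin U] card_G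
        by (auto simp: cd_measure_def simp flip: power_add)
    next
      case 4
      then have c: "c \<in> carrier G - A" "c' \<in> carrier G - A"
        using U centralizer_subset[of G U] by auto
      \<comment> \<open>Each of the two sets centralizes an element of the other that lies outside
        \<open>A\<close>.\<close>
      have "U \<subseteq> centralizer G {c'}" "?C \<subseteq> centralizer G {c}"
        using 4 U by (auto simp: centralizer_def)
      then have "card U \<le> p ^ 3" "card ?C \<le> p ^ 3"
        using card_mono[OF finC] small c by (meson le_trans)+
      then have "card U * card ?C \<le> p ^ 3 * p ^ 3"
        by (rule mult_le_mono)
      also have "\<dots> < p ^ 8"
        using p by (simp flip: power_add)
      finally show ?thesis
        by (simp add: cd_measure_def)
    qed
  qed
  \<comment> \<open>\<open>Z\<close> and \<open>A\<close> are themselves centralizers, of the whole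
    group and of \<open>A\<close>.\<close>
  have sub: "subgroup Z G" "subgroup A G" "subgroup (carrier G) G"
    using subgroup_centralizer[OF assms(1), of A] subgroup_centralizer[OF assms(1), of "carrier G"]
      C_A center AG subgroup_self by (auto simp: group_center_def)
  have "max_cd_measure G = p ^ 8"
    unfolding max_cd_measure_def
  proof (rule Max_eqI)
    have "{cd_measure G U |U. subgroup U G} \<subseteq> cd_measure G ` Pow (carrier G)"
      by (auto dest: subgroup.subset)
    then show "finite {cd_measure G U |U. subgroup U G}"
      using fin by (meson finite_Pow_iff finite_imageI finite_subset)
    show "p ^ 8 \<in> {cd_measure G U |U. subgroup U G}"
      using m(2) sub(2) by (intro CollectI exI[of _ A]) simp
  qed (use bound in \<open>auto dest: subgroup.subset\<close>)
  then show "chermak_delgado_lattice G = {group_center G, A, carrier G}"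
    using m sub bound center
    by (auto simp: chermak_delgado_lattice_def dest: subgroup.subset)
  show "subgroup A G" "group_center G \<subset> A" "A \<subset> carrier G"
    using sub ZA' AG' center by auto
qed

section \<open>Quadratic nonresidues\<close>

text \<open>Squaring identifies the residues 1 and -1, which differ for \<open>p > 2\<close>. A
  self-map of a finite set that is not injective is not surjective.\<close>

lemma ex_quadratic_nonresidue:
  fixes p :: int
  assumes "2 < p"
  shows "\<exists>d. \<forall>x. \<not> [x ^ 2 = d] (mod p)"
proof (rule ccontr)
  let ?f = "\<lambda>x. x ^ 2 mod p" and ?R = "{0..<p}"
  assume "\<not> ?thesis"
  then have *: "\<exists>x. x ^ 2 mod p = d mod p" for d
    by (auto simp: cong_def)
  have "?R \<subseteq> ?f ` ?R"
  proof
    fix d assume "d \<in> ?R"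
    moreover obtain x where "x ^ 2 mod p = d mod p"
      using * by blast
    ultimately have "d = ?f (x mod p)" "x mod p \<in> ?R"
      using assms by (auto simp: power_mod)
    then show "d \<in> ?f ` ?R"
      by blast
  qed
  then have inj: "inj_on ?f ?R"
    by (intro finite_surj_inj) auto
  have eq: "?f 1 = ?f (p - 1)"
    by (simp add: power2_eq_square mod_eq_dvd_iff algebra_simps)
  have "1 = p - 1"
    using assms by (intro inj_onD[OF inj eq]) auto
  then show False
    using assms by simp
qed

section \<open>The twisted Heisenberg group over GF(p^2), in integer coordinates\<close>

text \<open>With \<open>r\<close> a square root of \<open>d\<close>, the tuple \<open>(x, y, b, b', c, c')\<close> stands for the triple
  \<open>(x + y r, b + b' r, c + c' r)\<close>. The twist is the term \<open>2 x y1\<close>, which is not symmetric in the two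
  factors; the terms \<open>x\<^sup>2 y1\<close> and \<open>2 x y y1 + x y1\<^sup>2\<close> form a cochain whose coboundary is
  \<open>(x + y r) * 2 x1 y2\<close>, which is what associativity requires. The factor 2 avoids halves in them.\<close>

type_synonym int6 = "int \<times> int \<times> int \<times> int \<times> int \<times> int"

locale chain_group =
  fixes p :: nat and d :: int
  assumes prime: "prime p" and odd: "odd p" and nonresidue: "\<not> [x ^ 2 = d] (mod int p)"
begin

lemma prime_int: "prime (int p)"
  using prime by simp

text \<open>The form is the norm of \<open>x + y r\<close> with \<open>r^2 = d\<close>. If
  \<open>y\<close> were invertible modulo \<open>p\<close>, the quotient of \<open>x\<close> by
  \<open>y\<close> would be a square root of \<open>d\<close>.\<close>

lemma norm_form_anisotropic:
  assumes "int p dvd x ^ 2 - d * y ^ 2"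
  shows "int p dvd x \<and> int p dvd y"
proof -
  have "int p dvd y"
  proof (rule ccontr)
    assume "\<not> int p dvd y"
    then have "coprime y (int p)"
      using prime_imp_coprime[OF prime_int] by (metis coprime_commute)
    then obtain z where z: "[y * z = 1] (mod int p)"
      using cong_solve_coprime_int by blast
    have "[x ^ 2 * z ^ 2 = (d * y ^ 2) * z ^ 2] (mod int p)"
      using assms by (intro cong_mult cong_refl) (simp add: cong_iff_dvd_diff)
    then have "[(x * z) ^ 2 = d * (y * z) ^ 2] (mod int p)"
      by (simp add: power_mult_distrib mult_ac)
    also have "[d * (y * z) ^ 2 = d * 1 ^ 2] (mod int p)"
      using z by (intro cong_mult cong_pow cong_refl)
    finally show False
      using nonresidue by simp
  qed
  moreover from this have "int p dvd d * y ^ 2"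
    by (simp add: power2_eq_square)
  then have "int p dvd x ^ 2"
    using assms by (metis dvd_diff_commute dvd_diffD1 dvd_add diff_add_cancel)
  ultimately show ?thesis
    using prime_int prime_dvd_power by blast
qed

text \<open>The first two hypotheses are the coordinates of \<open>(x + y r)(b + b' r) = 0\<close>.
  Multiplying by the conjugate \<open>x - y r\<close> leaves the norm times \<open>b\<close> and
  times \<open>b'\<close>.\<close>

lemma no_zero_divisors:
  assumes "int p dvd x * b + d * y * b'" and "int p dvd x * b' + y * b"
    and "\<not> (int p dvd x \<and> int p dvd y)"
  shows "int p dvd b \<and> int p dvd b'"
proof -
  have "(x ^ 2 - d * y ^ 2) * b = x * (x * b + d * y * b') - d * y * (x * b' + y * b)"
    "(x ^ 2 - d * y ^ 2) * b' = x * (x * b' + y * b) - y * (x * b + d * y * b')"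
    by (simp_all add: algebra_simps power2_eq_square)
  then have "int p dvd (x ^ 2 - d * y ^ 2) * b" "int p dvd (x ^ 2 - d * y ^ 2) * b'"
    using assms(1,2) by (metis dvd_diff dvd_mult)+
  then show ?thesis
    using norm_form_anisotropic assms(3) prime_dvd_mult_iff[OF prime_int] by blast
qed

abbreviation R :: "int set" where
  "R \<equiv> {0..<int p}"

definition int_mul ::
  "int6 \<Rightarrow> int6 \<Rightarrow> int6" where
  "int_mul = (\<lambda>(x, y, b, b', c, c') (x1, y1, b1, b1', c1, c1').
    (x + x1, y + y1, b + b1 + 2 * x * y1, b' + b1',
     c + c1 + (x * b1 + d * y * b1') + x ^ 2 * y1,
     c' + c1' + (x * b1' + y * b1) + (2 * x * y * y1 + x * y1 ^ 2)))"

definition reduce ::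
  "int6 \<Rightarrow> int6" where
  "reduce = (\<lambda>(x, y, b, b', c, c').
    (x mod int p, y mod int p, b mod int p, b' mod int p, c mod int p, c' mod int p))"

definition mul ::
  "int6 \<Rightarrow> int6 \<Rightarrow> int6" where
  "mul g h = reduce (int_mul g h)"

text \<open>Before reduction this is an identity of integer polynomials; residues enter only
  afterwards, through \<open>reduce\<close>.\<close>

lemma int_mul_assoc: "int_mul (int_mul g h) k = int_mul g (int_mul h k)"
  by (cases g, cases h, cases k) (simp add: int_mul_def algebra_simps power2_eq_square)

text \<open>Every coordinate of \<open>int_mul\<close> is a polynomial with integer coefficients and
  so respects congruence.\<close>

lemma reduce_int_mul: "reduce (int_mul (reduce g) (reduce h)) = reduce (int_mul g h)"
proof -
  have *: "[u = v] (mod m) \<Longrightarrow> [u mod m = v] (mod m)" for u v m :: int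
    by (simp add: cong_def)
  show ?thesis
    by (cases g, cases h)
      (simp only: reduce_def int_mul_def prod.case prod.inject flip: cong_def,
        intro conjI cong_add cong_mult cong_pow * cong_refl)
qed

lemma reduce_reduce: "reduce (reduce g) = reduce g"
  by (cases g) (simp add: reduce_def)

lemma reduce_int_mul_left: "reduce (int_mul (reduce g) h) = reduce (int_mul g h)"
  and reduce_int_mul_right: "reduce (int_mul g (reduce h)) = reduce (int_mul g h)"
  by (metis reduce_int_mul reduce_reduce)+

definition P :: "int6 monoid" where
  "P = \<lparr>carrier = R \<times> R \<times> R \<times> R \<times> R \<times> R, monoid.mult = mul, one = (0, 0, 0, 0, 0, 0)\<rparr>"

definition A :: "int6 set" where
  "A = {0} \<times> {0} \<times> R \<times> R \<times> R \<times> R"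

definition Z :: "int6 set" where
  "Z = {0} \<times> {0} \<times> {0} \<times> {0} \<times> R \<times> R"

lemma p_pos: "0 < p"
  using prime by (rule prime_gt_0_nat)

lemma reduce_in_carrier: "reduce g \<in> carrier P"
  using p_pos by (cases g) (simp add: reduce_def P_def)

lemma reduce_carrier: "g \<in> carrier P \<Longrightarrow> reduce g = g"
  by (cases g) (simp add: reduce_def P_def)

lemma group_P: "group P"
proof (rule groupI)
  show "g \<otimes>\<^bsub>P\<^esub> h \<in> carrier P" for g h
    using reduce_in_carrier by (simp add: P_def mul_def)
  show "\<one>\<^bsub>P\<^esub> \<in> carrier P"
    using p_pos by (auto simp: P_def)
  show "g \<otimes>\<^bsub>P\<^esub> h \<otimes>\<^bsub>P\<^esub> k = g \<otimes>\<^bsub>P\<^esub> (h \<otimes>\<^bsub>P\<^esub> k)" for g h k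
    by (simp add: P_def mul_def reduce_int_mul_left reduce_int_mul_right int_mul_assoc)
next
  fix g assume g: "g \<in> carrier P"
  have "int_mul (0, 0, 0, 0, 0, 0) g = g"
    by (cases g) (simp add: int_mul_def)
  then show "\<one>\<^bsub>P\<^esub> \<otimes>\<^bsub>P\<^esub> g = g"
    using reduce_carrier[OF g] by (simp add: P_def mul_def)
  obtain x y b b' c c' where xy: "g = (x, y, b, b', c, c')"
    by (cases g)
  \<comment> \<open>Found by solving for a left inverse over the integers, one coordinate after
    another.\<close>
  let ?h = "(- x, - y, - b + 2 * x * y, - b', - c + x * b + d * y * b' - x ^ 2 * y,
    - c' + x * b' + y * b - x * y ^ 2)"
  have "int_mul ?h g = (0, 0, 0, 0, 0, 0)"
    by (simp add: int_mul_def xy algebra_simps power2_eq_square)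
  then have "reduce ?h \<otimes>\<^bsub>P\<^esub> g = \<one>\<^bsub>P\<^esub>"
    by (simp add: P_def mul_def reduce_int_mul_left) (simp add: reduce_def)
  then show "\<exists>h\<in>carrier P. h \<otimes>\<^bsub>P\<^esub> g = \<one>\<^bsub>P\<^esub>"
    using reduce_in_carrier by blast
qed

section \<open>Commutation and centralizers in the concrete group\<close>

text \<open>The first condition comes from the twist in the \<open>b\<close> coordinate, with the
  factor 2 cancelled because \<open>p\<close> is odd. It makes \<open>(x, y)\<close> and
  \<open>(x1, y1)\<close> linearly dependent over GF(p).\<close>

lemma commute_iff:
  "mul (x, y, b, b', c, c') (x1, y1, b1, b1', c1, c1') =
    mul (x1, y1, b1, b1', c1, c1') (x, y, b, b', c, c') \<longleftrightarrow>
   int p dvd x * y1 - x1 * y \<and>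
   int p dvd (x * b1 + d * y * b1' + x ^ 2 * y1) - (x1 * b + d * y1 * b' + x1 ^ 2 * y) \<and>
   int p dvd (x * b1' + y * b1 + 2 * x * y * y1 + x * y1 ^ 2) -
     (x1 * b' + y1 * b + 2 * x1 * y1 * y + x1 * y ^ 2)"
proof -
  have "\<not> int p dvd 2"
  proof
    assume "int p dvd 2"
    then have "int p dvd int 2"
      by simp
    then have "p dvd 2"
      by (simp only: int_dvd_int_iff)
    then have "p = 2"
      using prime two_is_prime_nat primes_dvd_imp_eq by blast
    then show False
      using odd by simp
  qed
  then have "int p dvd 2 * k \<longleftrightarrow> int p dvd k" for k
    using prime_dvd_mult_iff[OF prime_int, of 2 k] by blast
  from this[of "x * y1 - x1 * y"] show ?thesis
    by (simp add: mul_def int_mul_def reduce_def mod_eq_dvd_iff algebra_simps)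
qed

lemma Z_central: "z \<in> Z \<Longrightarrow> g \<in> carrier P \<Longrightarrow> mul z g = mul g z"
  by (cases z, cases g) (simp add: Z_def commute_iff)

lemma A_commuting: "a \<in> A \<Longrightarrow> b \<in> A \<Longrightarrow> mul a b = mul b a"
  by (cases a, cases b) (simp add: A_def commute_iff)

lemma residue_eqI: "x \<in> R \<Longrightarrow> y \<in> R \<Longrightarrow> int p dvd x - y \<Longrightarrow> x = y"
  by (simp add: mod_eq_dvd_iff[symmetric])

text \<open>For \<open>a\<close> in \<open>A\<close> the conditions collapse to the vanishing of the
  field product \<open>(x + y r)(b + b' r)\<close>.\<close>

lemma A_noncommuting:
  assumes "a \<in> A - Z" and "g \<in> carrier P - A"
  shows "mul a g \<noteq> mul g a"
proof
  assume *: "mul a g = mul g a"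
  obtain b b' c c' where a: "a = (0, 0, b, b', c, c')" "b \<in> R" "b' \<in> R" "\<not> (b = 0 \<and> b' = 0)"
    using assms(1) by (cases a) (auto simp: A_def Z_def)
  obtain x y b1 b1' c1 c1' where g: "g = (x, y, b1, b1', c1, c1')" "x \<in> R" "y \<in> R"
    "\<not> (x = 0 \<and> y = 0)"
    using assms(2) by (cases g) (auto simp: A_def P_def)
  have "\<not> (int p dvd x \<and> int p dvd y)"
    using g residue_eqI[of _ 0] p_pos by auto
  then have "int p dvd b \<and> int p dvd b'"
    using *[symmetric] no_zero_divisors[of x b y b'] by (simp add: a g commute_iff)
  then show False
    using a residue_eqI[of _ 0] p_pos by auto
qed

text \<open>Dependence on \<open>(x, y)\<close> leaves \<open>p\<close> choices for
  \<open>(x1, y1)\<close>. These fix \<open>b1\<close> and \<open>b1'\<close> through multiplication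
  by the nonzero \<open>x + y r\<close>, and only \<open>c1, c1'\<close> remain free.\<close>

lemma card_centralizer_le:
  assumes "c \<in> carrier P - A"
  shows "card (centralizer P {c}) \<le> p ^ 3"
proof -
  obtain x y b b' w w' where c: "c = (x, y, b, b', w, w')" "x \<in> R" "y \<in> R" "\<not> (x = 0 \<and> y = 0)"
    using assms by (cases c) (auto simp: A_def P_def)
  have nz: "\<not> (int p dvd x \<and> int p dvd y)"
    using c residue_eqI[of _ 0] p_pos by auto
  \<comment> \<open>The coordinate kept is the one that determines the other on the line through
    \<open>(x, y)\<close>: \<open>x1\<close> if \<open>x\<close> is nonzero, else
    \<open>y1\<close>.\<close>
  define f where "f = (\<lambda>(x1, y1, b1 :: int, b1' :: int, c1 :: int, c1' :: int).
    (if int p dvd x then y1 else x1 :: int, c1, c1'))"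
  have "inj_on f (centralizer P {c})"
  proof (rule inj_onI)
    fix g h assume gh: "g \<in> centralizer P {c}" "h \<in> centralizer P {c}" "f g = f h"
    obtain x1 y1 b1 b1' c1 c1' where g: "g = (x1, y1, b1, b1', c1, c1')"
      by (cases g)
    obtain x2 y2 b2 b2' c2 c2' where h: "h = (x2, y2, b2, b2', c2, c2')"
      by (cases h)
    have mem: "x1 \<in> R" "y1 \<in> R" "b1 \<in> R" "b1' \<in> R" "x2 \<in> R" "y2 \<in> R" "b2 \<in> R" "b2' \<in> R"
      using gh by (auto simp: g h centralizer_def P_def)
    have comm: "mul c g = mul g c" "mul c h = mul h c"
      using gh by (auto simp: centralizer_def P_def)
    note comm = comm[unfolded c g h commute_iff]
    have "int p dvd (x * y1 - x1 * y) - (x * y2 - x2 * y)"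
      using comm by (blast intro: dvd_diff)
    then have xy: "int p dvd x * (y1 - y2) - y * (x1 - x2)"
      by (simp add: algebra_simps)
    have s: "x1 = x2 \<and> y1 = y2"
    proof (cases "int p dvd x")
      case True
      then have "\<not> int p dvd y" "y1 = y2"
        using nz gh(3) by (auto simp: f_def g h)
      then show ?thesis
        using xy prime_int residue_eqI mem by (simp add: prime_dvd_mult_iff)
    next
      case False
      then have "x1 = x2"
        using gh(3) by (auto simp: f_def g h)
      then show ?thesis
        using False xy prime_int residue_eqI mem by (simp add: prime_dvd_mult_iff)
    qed
    \<comment> \<open>Once the first two coordinates agree, the nonlinear terms cancel in the
      difference of the two commutation conditions.\<close>
    have "int p dvd x * (b1 - b2) + d * y * (b1' - b2')"
      using dvd_diff[OF comm(1)[THEN conjunct2, THEN conjunct1] comm(2)[THEN conjunct2, THEN conjunct1]]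
      by (simp add: s algebra_simps)
    moreover have "int p dvd x * (b1' - b2') + y * (b1 - b2)"
      using dvd_diff[OF comm(1)[THEN conjunct2, THEN conjunct2] comm(2)[THEN conjunct2, THEN conjunct2]]
      by (simp add: s algebra_simps)
    ultimately have "b1 = b2 \<and> b1' = b2'"
      using no_zero_divisors nz residue_eqI mem by blast
    then show "g = h"
      using gh(3) s by (auto simp: f_def g h)
  qed
  moreover have "f ` centralizer P {c} \<subseteq> R \<times> R \<times> R"
    by (auto simp: f_def centralizer_def P_def)
  ultimately have "card (centralizer P {c}) \<le> card (R \<times> R \<times> R)"
    by (intro card_inj_on_le) auto
  then show ?thesis
    by (simp add: card_cartesian_product power3_eq_cube mult_ac)
qed

end

section \<open>Transport to a group of natural numbers\<close>

theorem corollary2p5: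
  fixes p :: nat
  assumes "prime p" and "odd p"
  shows "\<exists>P :: nat monoid. group P \<and> order P = p ^ 6 \<and>
           (\<exists>A. subgroup A P \<and> group_center P \<subset> A \<and> A \<subset> carrier P \<and>
                chermak_delgado_lattice P = {group_center P, A, carrier P})"
proof -
  have p: "2 < p"
    using assms by (metis nat_less_le prime_ge_2_nat even_numeral)
  then obtain d where "\<And>x. \<not> [x ^ 2 = d] (mod int p)"
    using ex_quadratic_nonresidue[of "int p"] by auto
  then interpret chain_group p d
    using assms by unfold_locales
  \<comment> \<open>The group must have natural numbers as elements, so \<open>P\<close> is copied
    along an injective encoding of the tuples; commutation and orders carry over.\<close>
  let ?f = "to_nat :: int6 \<Rightarrow> nat"
  define Q where "Q = image_group ?f P"
  have inj: "inj ?f"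
    by simp
  have "group Q"
    unfolding Q_def using group_P inj by (intro group.inj_imp_image_group_is_group) (auto intro: inj_on_subset)
  have carrier: "carrier Q = ?f ` carrier P"
    by (simp add: Q_def image_group_def)
  have mult: "?f g \<otimes>\<^bsub>Q\<^esub> ?f h = ?f (mul g h)" if "g \<in> carrier P" "h \<in> carrier P" for g h
    using that inj_on_subset[OF inj, of "carrier P"] by (simp add: Q_def image_group_def P_def)
  have AP: "A \<subseteq> carrier P" and ZA: "Z \<subseteq> A"
    using p by (auto simp: A_def Z_def P_def)
  have comm: "g \<otimes>\<^bsub>Q\<^esub> h = h \<otimes>\<^bsub>Q\<^esub> g \<longleftrightarrow> mul g' h' = mul h' g'"
    if "g = ?f g'" "h = ?f h'" "g' \<in> carrier P" "h' \<in> carrier P" for g h g' h'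
    using that by (simp add: mult)
  have cent: "centralizer Q {?f c} = ?f ` centralizer P {c}" if "c \<in> carrier P" for c
    using that comm by (auto simp: centralizer_def carrier P_def)
  have card_Q: "card (carrier Q) = p ^ 6"
    by (simp add: carrier card_image inj P_def card_cartesian_product numeral_eq_Suc mult_ac)
  have one_less: "1 < p"
    using p by simp
  have cards: "card (?f ` A) = p ^ 4" "card (?f ` Z) = p ^ 2"
    by (simp_all add: card_image A_def Z_def card_cartesian_product numeral_eq_Suc mult_ac)
  have subs: "?f ` Z \<subseteq> ?f ` A" "?f ` A \<subseteq> carrier Q"
    using AP ZA by (auto simp: carrier)
  have central: "z \<otimes>\<^bsub>Q\<^esub> g = g \<otimes>\<^bsub>Q\<^esub> z" if z: "z \<in> ?f ` Z" and g: "g \<in> carrier Q" for z g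
  proof -
    obtain z' g' where "z = ?f z'" "g = ?f g'" "z' \<in> Z" "g' \<in> carrier P"
      using z g unfolding carrier by blast
    then show ?thesis
      using comm[of z z' g g'] Z_central[of z' g'] AP ZA by blast
  qed
  have commuting: "a \<otimes>\<^bsub>Q\<^esub> b = b \<otimes>\<^bsub>Q\<^esub> a" if "a \<in> ?f ` A" and "b \<in> ?f ` A" for a b
  proof -
    obtain a' b' where "a = ?f a'" "b = ?f b'" "a' \<in> A" "b' \<in> A"
      using \<open>a \<in> ?f ` A\<close> \<open>b \<in> ?f ` A\<close> by blast
    then show ?thesis
      using comm[of a a' b b'] A_commuting[of a' b'] AP by blast
  qed
  have noncommuting: "a \<otimes>\<^bsub>Q\<^esub> g \<noteq> g \<otimes>\<^bsub>Q\<^esub> a" if a: "a \<in> ?f ` A - ?f ` Z" and g: "g \<in> carrier Q - ?f ` A" for a g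
  proof -
    obtain a' g' where "a = ?f a'" "g = ?f g'" "a' \<in> A - Z" "g' \<in> carrier P - A"
      using a g unfolding carrier by blast
    then show ?thesis
      using comm[of a a' g g'] A_noncommuting[of a' g'] AP by blast
  qed
  have small: "card (centralizer Q {c}) \<le> p ^ 3" if c: "c \<in> carrier Q - ?f ` A" for c
  proof -
    obtain c' where "c = ?f c'" "c' \<in> carrier P - A"
      using c unfolding carrier by blast
    then show ?thesis
      using card_centralizer_le[of c'] by (simp add: cent card_image inj)
  qed
  have "subgroup (?f ` A) Q" "group_center Q \<subset> ?f ` A" "?f ` A \<subset> carrier Q"
    "chermak_delgado_lattice Q = {group_center Q, ?f ` A, carrier Q}"
    by (rule chermak_delgado_chain[OF \<open>group Q\<close> one_less card_Q cards subs];
        (rule central commuting noncommuting small; assumption))+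
  then show ?thesis
    using \<open>group Q\<close> card_Q by (intro exI[of _ Q] exI[of _ "?f ` A"] conjI) (simp_all add: order_def)
qed

end
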